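(* (1) $\mathrm{S}$ is $\Pi^0_1$-complete. (2) $\mathrm{T}$, $\mathrm{ET}$, and $\mathrm{T}\cap\mathrm{S}$ are $\Pi^0_2$-complete. (3) $H_i$ and $H_{ii}$ are $\Sigma^0_1$-complete; $H_{iii}$ is $\Pi^0_1$-complete.
   Context: $(\varphi_e)_{e\in\mathbb{N}}$ is a fixed standard acceptable numbering of the unary partial computable functions and $\mathbf{M}=\{p\in\mathbb{N}:\varphi_p(0)\!\downarrow=1\}$. Define the following sets of indices (over the standard domain $(\mathbb{N},\mathbf{M})$): $\mathrm{S}=\{a:\forall p\,(\varphi_a(p)\!\downarrow=1\Rightarrow p\notin\mathbf{M})\}$ (sound adjudicators); $\mathrm{T}=\{a:\forall p\ \varphi_a(p)\!\downarrow\}$ (total adjudicators); $\mathrm{ET}=\{a:\forall p\ \varphi_a(p)\!\downarrow=1\}$. Fix a total computable function $d$ with the following property, writing $\delta_a=d(a)$: for every $a$, $\varphi_{\delta_a}(0)$ converges to $1$ if $\varphi_a(\delta_a)\!\downarrow=1$, converges to $0$ if $\varphi_a(\delta_a)\!\downarrow\neq1$, and diverges if $\varphi_a(\delta_a)\!\uparrow$ (so $\delta_a\in\mathbf{M}\iff\varphi_a(\delta_a)\!\downarrow=1$); such $d$ exists by the recursion theorem with parameters. Then $H_i=\{a:\varphi_a(\delta_a)\!\downarrow=1\}$, $H_{ii}=\{a:\varphi_a(\delta_a)\!\downarrow\neq1\}$ (converges with a value other than $1$), $H_{iii}=\{a:\varphi_a(\delta_a)\!\uparrow\}$. Completeness is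 with respect to many-one reducibility. *)

theory Defs
  imports Main
begin

text \<open>
  A \<open>k\<close>-ary partial function is represented by a map from lists to optional numbers, where
  \<^term>\<open>None\<close> means divergence; its values on lists of length other than \<open>k\<close> carry no meaning.
\<close>

definition compose :: "(nat list \<rightharpoonup> nat) \<Rightarrow> (nat list \<rightharpoonup> nat) list \<Rightarrow> (nat list \<rightharpoonup> nat)" where
  "compose f gs xs = Option.bind (those (map (\<lambda>g. g xs) gs)) f"

definition prim_recursion ::
    "(nat list \<rightharpoonup> nat) \<Rightarrow> (nat list \<rightharpoonup> nat) \<Rightarrow> (nat list \<rightharpoonup> nat)" where
  "prim_recursion g h xs =
     rec_nat (g (tl xs)) (\<lambda>m r. Option.bind r (\<lambda>y. h (m # y # tl xs))) (hd xs)"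

text \<open>All values below the first zero must be defined.\<close>

definition minimization :: "(nat list \<rightharpoonup> nat) \<Rightarrow> (nat list \<rightharpoonup> nat)" where
  "minimization f xs =
     (if \<exists>y. f (y # xs) = Some 0 \<and> (\<forall>z<y. \<exists>v. f (z # xs) = Some (Suc v))
      then Some (LEAST y. f (y # xs) = Some 0) else None)"

inductive partial_recursive :: "nat \<Rightarrow> (nat list \<rightharpoonup> nat) \<Rightarrow> bool" where
  zero: "partial_recursive k (\<lambda>xs. Some 0)"
| succ: "partial_recursive 1 (\<lambda>xs. Some (Suc (hd xs)))"
| proj: "i < k \<Longrightarrow> partial_recursive k (\<lambda>xs. Some (xs ! i))"
| comp: "partial_recursive (length gs) f \<Longrightarrow> \<forall>g\<in>set gs. partial_recursive k g
           \<Longrightarrow> partial_recursive k (compose f gs)"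
| prec: "partial_recursive k g \<Longrightarrow> partial_recursive (k + 2) h
           \<Longrightarrow> partial_recursive (k + 1) (prim_recursion g h)"
| minim: "partial_recursive (k + 1) f \<Longrightarrow> partial_recursive k (minimization f)"

definition partial_computable1 :: "(nat \<rightharpoonup> nat) \<Rightarrow> bool" where
  "partial_computable1 f \<longleftrightarrow> (\<exists>F. partial_recursive 1 F \<and> (\<forall>x. F [x] = f x))"

definition partial_computable2 :: "(nat \<Rightarrow> nat \<rightharpoonup> nat) \<Rightarrow> bool" where
  "partial_computable2 f \<longleftrightarrow> (\<exists>F. partial_recursive 2 F \<and> (\<forall>x y. F [x, y] = f x y))"

definition total_computable :: "(nat \<Rightarrow> nat) \<Rightarrow> bool" where
  "total_computable f \<longleftrightarrow> partial_computable1 (\<lambda>x. Some (f x))"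

definition decidable :: "nat \<Rightarrow> (nat list \<Rightarrow> bool) \<Rightarrow> bool" where
  "decidable k R \<longleftrightarrow>
     (\<exists>F. partial_recursive k F \<and>
          (\<forall>xs. length xs = k \<longrightarrow> F xs = Some (if R xs then 1 else 0)))"

text \<open>
  Acceptability in the sense of Rogers: the numbering enumerates exactly the unary partial
  computable functions, its universal function is partial computable, and it has the s-m-n
  property. The first clause follows from the other two; it is kept for readability.
\<close>

definition acceptable_numbering :: "(nat \<Rightarrow> nat \<rightharpoonup> nat) \<Rightarrow> bool" where
  "acceptable_numbering \<phi> \<longleftrightarrow>
     range \<phi> = {f. partial_computable1 f} \<and>
     partial_computable2 \<phi> \<and>
     (\<forall>\<psi>. partial_computable2 \<psi> \<longrightarrow>
        (\<exists>s. total_computable s \<and> (\<forall>x y. \<phi> (s x) y = \<psi> x y)))"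

definition Sigma01 :: "nat set set" where
  "Sigma01 = {A. \<exists>R. decidable 2 R \<and> A = {x. \<exists>y. R [x, y]}}"

definition Pi01 :: "nat set set" where
  "Pi01 = {A. \<exists>R. decidable 2 R \<and> A = {x. \<forall>y. R [x, y]}}"

definition Pi02 :: "nat set set" where
  "Pi02 = {A. \<exists>R. decidable 3 R \<and> A = {x. \<forall>y. \<exists>z. R [x, y, z]}}"

definition many_one_reducible :: "nat set \<Rightarrow> nat set \<Rightarrow> bool" (infix "\<le>\<^sub>m" 50) where
  "A \<le>\<^sub>m B \<longleftrightarrow> (\<exists>f. total_computable f \<and> (\<forall>x. x \<in> A \<longleftrightarrow> f x \<in> B))"

definition complete_for :: "nat set set \<Rightarrow> nat set \<Rightarrow> bool" where
  "complete_for \<C> B \<longleftrightarrow> B \<in> \<C> \<and> (\<forall>A\<in>\<C>. A \<le>\<^sub>m B)"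

definition M_set :: "(nat \<Rightarrow> nat \<rightharpoonup> nat) \<Rightarrow> nat set" where
  "M_set \<phi> = {p. \<phi> p 0 = Some 1}"

definition sound_adjudicators :: "(nat \<Rightarrow> nat \<rightharpoonup> nat) \<Rightarrow> nat set" where
  "sound_adjudicators \<phi> = {a. \<forall>p. \<phi> a p = Some 1 \<longrightarrow> p \<notin> M_set \<phi>}"

definition total_adjudicators :: "(nat \<Rightarrow> nat \<rightharpoonup> nat) \<Rightarrow> nat set" where
  "total_adjudicators \<phi> = {a. \<forall>p. \<phi> a p \<noteq> None}"

definition ET_set :: "(nat \<Rightarrow> nat \<rightharpoonup> nat) \<Rightarrow> nat set" where
  "ET_set \<phi> = {a. \<forall>p. \<phi> a p = Some 1}"

definition diagonal_function :: "(nat \<Rightarrow> nat \<rightharpoonup> nat) \<Rightarrow> (nat \<Rightarrow> nat) \<Rightarrow> bool" where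
  "diagonal_function \<phi> d \<longleftrightarrow>
     total_computable d \<and>
     (\<forall>a. \<phi> (d a) 0 =
            (case \<phi> a (d a) of
               None \<Rightarrow> None
             | Some v \<Rightarrow> if v = 1 then Some 1 else Some 0))"

definition H_i :: "(nat \<Rightarrow> nat \<rightharpoonup> nat) \<Rightarrow> (nat \<Rightarrow> nat) \<Rightarrow> nat set" where
  "H_i \<phi> d = {a. \<phi> a (d a) = Some 1}"

definition H_ii :: "(nat \<Rightarrow> nat \<rightharpoonup> nat) \<Rightarrow> (nat \<Rightarrow> nat) \<Rightarrow> nat set" where
  "H_ii \<phi> d = {a. \<exists>v. \<phi> a (d a) = Some v \<and> v \<noteq> 1}"

definition H_iii :: "(nat \<Rightarrow> nat \<rightharpoonup> nat) \<Rightarrow> (nat \<Rightarrow> nat) \<Rightarrow> nat set" where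
  "H_iii \<phi> d = {a. \<phi> a (d a) = None}"

end

theory Submission
  imports Defs
begin

text \<open>
  Every partial recursive function is the limit of a monotone family of computable total stage
  approximations (a Kleene normal form for a single function, proved by induction on its
  construction). Applied to the universal function this gives the upper bounds; monotonicity in
  the stage lets one number bound all unbounded searches at once, so no pairing function is
  needed. For hardness, the s-m-n property is applied to the function that on input \<open>(x, y)\<close>
  searches for \<open>z\<close> with \<open>R [x, y, z]\<close> and then returns \<open>1\<close> or \<open>0\<close>.
\<close>

section \<open>Total computable functions and decidable relations\<close>

text \<open>Total functions keep options out of the constructions below. Agreement is asked only at
  length \<open>k\<close>, since values on other lists carry no meaning.\<close>

definition computable :: "nat \<Rightarrow> (nat list \<Rightarrow> nat) \<Rightarrow> bool" where
  "computable k f \<longleftrightarrow> (\<exists>F. partial_recursive k F \<and> (\<forall>xs. length xs = k \<longrightarrow> F xs = Some (f xs)))"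

lemma decidable_iff_computable: "decidable k R \<longleftrightarrow> computable k (\<lambda>xs. if R xs then 1 else 0)"
  by (simp add: decidable_def computable_def)

lemma computable_cong:
  "computable k f \<Longrightarrow> (\<And>xs. length xs = k \<Longrightarrow> f xs = g xs) \<Longrightarrow> computable k g"
  unfolding computable_def by metis

lemma decidable_cong:
  "decidable k P \<Longrightarrow> (\<And>xs. length xs = k \<Longrightarrow> P xs \<longleftrightarrow> Q xs) \<Longrightarrow> decidable k Q"
  unfolding decidable_iff_computable by (erule computable_cong) simp

lemma those_map:
  "those (map h l) = (if \<forall>x\<in>set l. h x \<noteq> None then Some (map (\<lambda>x. the (h x)) l) else None)"
  by (induction l) (auto split: option.splits)

lemma computable_comp:
  assumes "computable n f" and "length gs = n" and "\<forall>g\<in>set gs. computable k g"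
  shows "computable k (\<lambda>xs. f (map (\<lambda>g. g xs) gs))"
proof -
  obtain F where F: "partial_recursive (length gs) F"
      "\<And>xs. length xs = length gs \<Longrightarrow> F xs = Some (f xs)"
    using assms(1,2) unfolding computable_def by blast
  obtain G where G: "\<And>g. g \<in> set gs \<Longrightarrow> partial_recursive k (G g)"
      "\<And>g xs. g \<in> set gs \<Longrightarrow> length xs = k \<Longrightarrow> G g xs = Some (g xs)"
    using assms(3) unfolding computable_def by metis
  have "partial_recursive k (compose F (map G gs))"
    using F(1) G(1) by (intro comp) auto
  moreover have "compose F (map G gs) xs = Some (f (map (\<lambda>g. g xs) gs))" if "length xs = k" for xs
  proof -
    have "those (map (\<lambda>g. G g xs) gs) = Some (map (\<lambda>g. g xs) gs)"
      using G(2) that by (auto simp: those_map)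
    then show ?thesis
      by (simp add: compose_def comp_def F(2))
  qed
  ultimately show ?thesis unfolding computable_def by blast
qed

lemma computable_subst:
  assumes "computable n f" and "length gs = n" and "\<forall>g\<in>set gs. computable k g"
    and "\<And>xs. length xs = k \<Longrightarrow> map (\<lambda>g. g xs) gs = h xs"
  shows "computable k (\<lambda>xs. f (h xs))"
proof (rule computable_cong)
  show "computable k (\<lambda>xs. f (map (\<lambda>g. g xs) gs))"
    using assms(1-3) by (intro computable_comp) auto
qed (simp add: assms(4))

lemma decidable_comp:
  assumes "decidable n P" and "length gs = n" and "\<forall>g\<in>set gs. computable k g"
  shows "decidable k (\<lambda>xs. P (map (\<lambda>g. g xs) gs))"
  using computable_comp[OF assms(1)[unfolded decidable_iff_computable] assms(2,3)]
  unfolding decidable_iff_computable .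

lemma computable_nth: "i < k \<Longrightarrow> computable k (\<lambda>xs. xs ! i)"
  unfolding computable_def using proj by blast

lemma computable_Suc: "computable k f \<Longrightarrow> computable k (\<lambda>xs. Suc (f xs))"
  using computable_comp[of 1 "\<lambda>xs. Suc (hd xs)" "[f]" k] succ
  by (auto simp: computable_def)

lemma computable_const: "computable k (\<lambda>xs. c)"
proof (induction c)
  case 0
  show ?case unfolding computable_def using zero by blast
qed (rule computable_Suc)

text \<open>With a symbolic arity the argument list cannot be written out entry by entry, so the
  kept tail is supplied by projections. An empty \<open>gs\<close> forgets leading arguments, and
  \<open>m = 0\<close> inserts new ones in front.\<close>

lemma computable_append_drop:
  assumes "computable n f" and "n = length gs + (k - m)" and "m \<le> k"
    and "\<forall>g\<in>set gs. computable k g"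
  shows "computable k (\<lambda>xs. f (map (\<lambda>g. g xs) gs @ drop m xs))"
proof (rule computable_subst[OF assms(1)])
  let ?gs = "gs @ map (\<lambda>i xs. xs ! i) [m..<k]"
  show "length ?gs = n"
    using assms(2,3) by simp
  show "\<forall>g\<in>set ?gs. computable k g"
    using assms(4) by (auto intro: computable_nth)
  show "map (\<lambda>g. g xs) ?gs = map (\<lambda>g. g xs) gs @ drop m xs" if "length xs = k" for xs
    using that by (auto intro: nth_equalityI)
qed

lemma decidable_append_drop:
  assumes "decidable n P" and "n = length gs + (k - m)" and "m \<le> k"
    and "\<forall>g\<in>set gs. computable k g"
  shows "decidable k (\<lambda>xs. P (map (\<lambda>g. g xs) gs @ drop m xs))"
  using computable_append_drop[OF assms(1)[unfolded decidable_iff_computable] assms(2-4)]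
  unfolding decidable_iff_computable .

text \<open>The bare recursion reads its counter as an extra first argument; \<open>b\<close>, which
  may depend on the parameters, is substituted there afterwards.\<close>

lemma computable_rec:
  assumes "computable k b" and "computable k g" and "computable (k + 2) h"
  shows "computable k (\<lambda>xs. rec_nat (g xs) (\<lambda>m r. h (m # r # xs)) (b xs))"
proof -
  obtain G where G: "partial_recursive k G" "\<And>xs. length xs = k \<Longrightarrow> G xs = Some (g xs)"
    using assms(2) unfolding computable_def by blast
  obtain H where H: "partial_recursive (k + 2) H"
      "\<And>xs. length xs = k + 2 \<Longrightarrow> H xs = Some (h xs)"
    using assms(3) unfolding computable_def by blast
  have "prim_recursion G H (n # xs) = Some (rec_nat (g xs) (\<lambda>m r. h (m # r # xs)) n)"
    if "length xs = k" for n xs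
    using that by (induction n) (auto simp: prim_recursion_def G H)
  then have "computable (Suc k) (\<lambda>xs. rec_nat (g (tl xs)) (\<lambda>m r. h (m # r # tl xs)) (hd xs))"
    using prec[OF G(1) H(1)] unfolding computable_def
    by (intro exI[of _ "prim_recursion G H"]) (auto simp: length_Suc_conv)
  from computable_append_drop[OF this, of "[b]" k 0] show ?thesis
    using assms(1) by simp
qed

text \<open>Recursion with counter \<open>c xs\<close>: the base case returns \<open>f\<close>, and
  a step that ignores the counter and the previous value returns \<open>g\<close> at every
  successor.\<close>

lemma computable_if_eq_0:
  assumes "computable k c" and "computable k f" and "computable k g"
  shows "computable k (\<lambda>xs. if c xs = 0 then f xs else g xs)"
proof -
  have "computable (k + 2) (\<lambda>xs. g (drop 2 xs))"
    using computable_append_drop[OF assms(3), of "[]" "k + 2" 2] by simp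
  then have "computable k (\<lambda>xs. rec_nat (f xs) (\<lambda>m r. g (drop 2 (m # r # xs))) (c xs))"
    using assms by (intro computable_rec)
  then show ?thesis
    by (rule computable_cong) (auto simp: gr0_conv_Suc)
qed

lemma computable_pred:
  assumes "computable k f"
  shows "computable k (\<lambda>xs. f xs - 1)"
proof -
  have "computable k (\<lambda>xs. rec_nat 0 (\<lambda>m r. (m # r # xs) ! 0) (f xs))"
    using assms by (intro computable_rec computable_const computable_nth) auto
  then show ?thesis
  proof (rule computable_cong)
    show "rec_nat 0 (\<lambda>m r. (m # r # xs) ! 0) (f xs) = f xs - 1" for xs
      by (cases "f xs") auto
  qed
qed

lemma computable_If:
  assumes "decidable k P" and "computable k f" and "computable k g"
  shows "computable k (\<lambda>xs. if P xs then f xs else g xs)"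
  using computable_if_eq_0[OF assms(1)[unfolded decidable_iff_computable] assms(3,2)]
  by (rule computable_cong) auto

lemma decidable_True: "decidable k (\<lambda>xs. True)"
  by (simp add: decidable_iff_computable computable_const)

lemma decidable_not: "decidable k P \<Longrightarrow> decidable k (\<lambda>xs. \<not> P xs)"
  using computable_If[OF _ computable_const[of k 0] computable_const[of k 1]]
  unfolding decidable_iff_computable[of k "\<lambda>xs. \<not> P xs"] by (rule computable_cong) auto

lemma decidable_conj:
  "decidable k P \<Longrightarrow> decidable k Q \<Longrightarrow> decidable k (\<lambda>xs. P xs \<and> Q xs)"
  using computable_If[OF _ _ computable_const[of k 0], of P "\<lambda>xs. if Q xs then 1 else 0"]
  unfolding decidable_iff_computable[of k Q] decidable_iff_computable[of k "\<lambda>xs. P xs \<and> Q xs"]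
  by (rule computable_cong) auto

lemma decidable_eq_const: "computable k f \<Longrightarrow> decidable k (\<lambda>xs. f xs = c)"
proof (induction c arbitrary: f)
  case 0
  show ?case
    unfolding decidable_iff_computable
    by (intro computable_if_eq_0 computable_const 0)
next
  case (Suc c)
  have "decidable k (\<lambda>xs. \<not> f xs = 0 \<and> f xs - 1 = c)"
    by (intro decidable_conj decidable_not Suc.IH computable_pred Suc.prems)
      (unfold decidable_iff_computable, intro computable_if_eq_0 computable_const Suc.prems)
  then show ?case
    by (rule decidable_cong) auto
qed

lemma decidable_ball_list:
  "(\<And>x. x \<in> set l \<Longrightarrow> decidable k (P x)) \<Longrightarrow> decidable k (\<lambda>xs. \<forall>x\<in>set l. P x xs)"
  by (induction l) (auto intro: decidable_True decidable_conj)

lemma decidable_all_less: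
  assumes "decidable (Suc k) P" and "computable k b"
  shows "decidable k (\<lambda>xs. \<forall>y<b xs. P (y # xs))"
proof -
  \<comment> \<open>Here \<open>ys = m # r # xs\<close>: the accumulator \<open>r\<close> is the
    truth value for all numbers below \<open>m\<close>, and it stays 0 after the first
    failure.\<close>
  define h where
    "h ys = (if ys ! 1 = 0 then 0 else if P (ys ! 0 # drop 2 ys) then 1 else 0 :: nat)" for ys
  have "decidable (k + 2) (\<lambda>ys. P (ys ! 0 # drop 2 ys))"
    using decidable_append_drop[OF assms(1), of "[\<lambda>ys. ys ! 0]" "k + 2" 2]
    by (simp add: computable_nth)
  then have "computable (k + 2) h"
    unfolding h_def by (intro computable_If computable_if_eq_0 computable_nth computable_const) auto
  then have "computable k (\<lambda>xs. rec_nat 1 (\<lambda>m r. h (m # r # xs)) (b xs))"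
    using assms by (intro computable_rec computable_const)
  moreover have "rec_nat 1 (\<lambda>m r. h (m # r # xs)) n = (if \<forall>y<n. P (y # xs) then 1 else 0)" for n xs
    by (induction n) (auto simp: h_def less_Suc_eq)
  ultimately show ?thesis
    unfolding decidable_iff_computable by simp
qed

section \<open>Stage approximations\<close>

text \<open>The value \<open>0\<close> of \<open>G\<close> stands for ``not yet defined'', the value \<open>Suc v\<close> for output \<open>v\<close>.\<close>

definition approximates :: "nat \<Rightarrow> (nat list \<Rightarrow> nat) \<Rightarrow> (nat list \<rightharpoonup> nat) \<Rightarrow> bool" where
  "approximates k G F \<longleftrightarrow> computable (Suc k) G \<and>
     (\<forall>xs s t v. length xs = k \<longrightarrow> s \<le> t \<longrightarrow> G (s # xs) = Suc v \<longrightarrow> G (t # xs) = Suc v) \<and>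
     (\<forall>xs v. length xs = k \<longrightarrow> F xs = Some v \<longleftrightarrow> (\<exists>t. G (t # xs) = Suc v))"

text \<open>By monotonicity an output present at one stage persists, so "some stage" becomes "all
  large stages". In this form finitely many conditions combine by filter reasoning, without
  computing a common stage.\<close>

lemma approximates_eventually:
  assumes "approximates k G F" and "length xs = k"
  shows "F xs = Some v \<longleftrightarrow> (\<forall>\<^sub>F t in sequentially. G (t # xs) = Suc v)"
  using assms unfolding approximates_def eventually_sequentially by (metis order_refl)

lemma approximatesI:
  assumes "computable (Suc k) G"
    and "\<And>xs s t v. length xs = k \<Longrightarrow> s \<le> t \<Longrightarrow> G (s # xs) = Suc v \<Longrightarrow> G (t # xs) = Suc v"
    and "\<And>xs t v. length xs = k \<Longrightarrow> G (t # xs) = Suc v \<Longrightarrow> F xs = Some v"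
    and "\<And>xs v. length xs = k \<Longrightarrow> F xs = Some v \<Longrightarrow> \<forall>\<^sub>F t in sequentially. G (t # xs) = Suc v"
  shows "approximates k G F"
  unfolding approximates_def
proof (intro conjI allI impI iffI)
  show "\<exists>t. G (t # xs) = Suc v" if "length xs = k" "F xs = Some v" for xs v
    using assms(4)[OF that] by (auto simp: eventually_sequentially)
qed (use assms(1-3) in blast)+

text \<open>A total function needs no waiting: the approximation ignores the stage.\<close>

lemma approximates_total:
  assumes "computable k f"
  shows "approximates k (\<lambda>xs. Suc (f (tl xs))) (\<lambda>xs. Some (f xs))"
proof (rule approximatesI)
  have "computable (Suc k) (\<lambda>xs. f (drop 1 xs))"
    using computable_append_drop[OF assms, of "[]" "Suc k" 1] by simp
  then show "computable (Suc k) (\<lambda>xs. Suc (f (tl xs)))"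
    by (auto simp: drop_Suc intro: computable_Suc)
qed auto

lemma approximates_compose:
  assumes F: "approximates (length gs) Fa F"
    and G: "\<And>g. g \<in> set gs \<Longrightarrow> approximates k (Ga g) g"
  shows "\<exists>A. approximates k A (compose F gs)"
proof (intro exI approximatesI)
  \<comment> \<open>The inner functions and the outer one all run at the same stage
    \<open>xs ! 0\<close>. On lists of length \<open>Suc k\<close> the part
    \<open>drop (Suc k) xs\<close> is empty; it gives the term the shape of
    \<open>computable_append_drop\<close>.\<close>
  let ?A = "\<lambda>xs. if \<forall>g\<in>set gs. \<not> Ga g xs = 0
    then Fa (map (\<lambda>h. h xs) ((\<lambda>xs. xs ! 0) # map (\<lambda>g xs. Ga g xs - 1) gs) @ drop (Suc k) xs) else 0"
  have Ga: "computable (Suc k) (Ga g)" if "g \<in> set gs" for g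
    using G[OF that] by (simp add: approximates_def)
  show "computable (Suc k) ?A"
  proof (intro computable_If computable_const decidable_ball_list decidable_not decidable_eq_const)
    have "computable (Suc (length gs)) Fa"
      using F by (simp add: approximates_def)
    then show "computable (Suc k) (\<lambda>xs. Fa (map (\<lambda>h. h xs)
        ((\<lambda>xs. xs ! 0) # map (\<lambda>g xs. Ga g xs - 1) gs) @ drop (Suc k) xs))"
      by (rule computable_append_drop) (auto intro: computable_nth computable_pred[simplified] Ga)
  qed (rule Ga)
  have A: "?A (t # xs) = (if \<forall>g\<in>set gs. Ga g (t # xs) \<noteq> 0
      then Fa (t # map (\<lambda>g. Ga g (t # xs) - 1) gs) else 0)" if "length xs = k" for t xs
    using that by (auto simp: comp_def)
  fix xs :: "nat list"
  assume len: "length xs = k"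
  show "?A (t # xs) = Suc v" if "s \<le> t" "?A (s # xs) = Suc v" for s t v
  proof -
    have s: "\<forall>g\<in>set gs. Ga g (s # xs) \<noteq> 0" "Fa (s # map (\<lambda>g. Ga g (s # xs) - 1) gs) = Suc v"
      using that(2) unfolding A[OF len] by (auto split: if_splits)
    \<comment> \<open>An inner value defined at stage \<open>s\<close> is final, so at stage
      \<open>t\<close> the outer approximation sees the same arguments.\<close>
    have *: "Ga g (t # xs) = Ga g (s # xs)" if "g \<in> set gs" for g
      using s(1) G[OF that] that len \<open>s \<le> t\<close> unfolding approximates_def by (metis not0_implies_Suc)
    have "Fa (t # map (\<lambda>g. Ga g (s # xs) - 1) gs) = Suc v"
      using F s(2) \<open>s \<le> t\<close> unfolding approximates_def by (metis length_map)
    then show ?thesis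
      unfolding A[OF len] using s(1) by (simp add: * cong: map_cong)
  qed
  show "compose F gs xs = Some v" if "?A (t # xs) = Suc v" for t v
  proof -
    have t: "\<forall>g\<in>set gs. Ga g (t # xs) \<noteq> 0" "Fa (t # map (\<lambda>g. Ga g (t # xs) - 1) gs) = Suc v"
      using that unfolding A[OF len] by (auto split: if_splits)
    have *: "g xs = Some (Ga g (t # xs) - 1)" if "g \<in> set gs" for g
      using t(1) G[OF that] that len unfolding approximates_def
      by (metis Suc_pred' bot_nat_0.not_eq_extremum)
    have "F (map (\<lambda>g. Ga g (t # xs) - 1) gs) = Some v"
      using F t(2) unfolding approximates_def by (metis length_map)
    then show ?thesis
      by (simp add: compose_def those_map * cong: map_cong)
  qed
  show "\<forall>\<^sub>F t in sequentially. ?A (t # xs) = Suc v" if "compose F gs xs = Some v" for v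
  proof -
    have def: "\<forall>g\<in>set gs. g xs \<noteq> None" and F_eq: "F (map (\<lambda>g. the (g xs)) gs) = Some v"
      using that by (auto simp: compose_def those_map split: if_splits)
    have "\<forall>\<^sub>F t in sequentially. Ga g (t # xs) = Suc (the (g xs))" if "g \<in> set gs" for g
      using def that by (subst approximates_eventually[OF G len, symmetric]) auto
    then have "\<forall>\<^sub>F t in sequentially. \<forall>g\<in>set gs. Ga g (t # xs) = Suc (the (g xs))"
      by (intro eventually_ball_finite) auto
    moreover have "\<forall>\<^sub>F t in sequentially. Fa (t # map (\<lambda>g. the (g xs)) gs) = Suc v"
      using F_eq by (subst approximates_eventually[OF F, symmetric]) auto
    ultimately show ?thesis
      unfolding A[OF len] by eventually_elim (simp cong: map_cong)
  qed
qed

lemma approximates_prim_recursion: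
  assumes G: "approximates k Ga G" and H: "approximates (k + 2) Ha H"
  shows "\<exists>A. approximates (k + 1) A (prim_recursion G H)"
proof (intro exI approximatesI)
  \<comment> \<open>Here \<open>ws = m # r # t # n # xs\<close>. The state \<open>r = 0\<close>
    propagates undefinedness; otherwise \<open>ws ! 1 - 1\<close> decodes the previous
    value.\<close>
  let ?h = "\<lambda>ws. if ws ! 1 = 0 then 0 else
    Ha (map (\<lambda>h. h ws) [\<lambda>ws. ws ! 2, \<lambda>ws. ws ! 0, \<lambda>ws. ws ! 1 - 1] @ drop 4 ws)"
  let ?A = "\<lambda>xs. rec_nat (Ga (map (\<lambda>h. h xs) [\<lambda>xs. xs ! 0] @ drop 2 xs))
    (\<lambda>m r. ?h (m # r # xs)) (xs ! 1)"
  define B where "B t xs = rec_nat (Ga (t # xs)) (\<lambda>m r. if r = 0 then 0 else Ha (t # m # (r - 1) # xs))"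
    for t xs
  have "?h (m # r # t # n # xs) = (if r = 0 then 0 else Ha (t # m # (r - 1) # xs))" for m r t n xs
    by (simp add: numeral_eq_Suc)
  then have A: "?A (t # n # xs) = B t xs n" for t n xs
    by (simp only: B_def) simp
  \<comment> \<open>\<open>B_Suc\<close> and \<open>P_Suc\<close> are matching successor equations
    for the approximation and the function, so the three claims below go through by induction on
    \<open>n\<close>.\<close>
  have B_Suc: "B t xs (Suc n) = Suc v \<longleftrightarrow> (\<exists>w. B t xs n = Suc w \<and> Ha (t # n # w # xs) = Suc v)"
    for t xs n v
    by (cases "B t xs n") (auto simp: B_def)
  have P_Suc: "prim_recursion G H (Suc n # xs) = Some v \<longleftrightarrow>
      (\<exists>w. prim_recursion G H (n # xs) = Some w \<and> H (n # w # xs) = Some v)" for xs n v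
    by (auto simp: prim_recursion_def bind_eq_Some_conv)
  show "computable (Suc (k + 1)) ?A"
  proof (intro computable_rec computable_if_eq_0 computable_const)
    have "computable (Suc k) Ga"
      using G by (simp add: approximates_def)
    then show "computable (Suc (k + 1)) (\<lambda>xs. Ga (map (\<lambda>h. h xs) [\<lambda>xs. xs ! 0] @ drop 2 xs))"
      by (rule computable_append_drop) (auto intro: computable_nth)
    have "computable (Suc (k + 2)) Ha"
      using H by (simp add: approximates_def)
    then show "computable (Suc (k + 1) + 2) (\<lambda>ws.
        Ha (map (\<lambda>h. h ws) [\<lambda>ws. ws ! 2, \<lambda>ws. ws ! 0, \<lambda>ws. ws ! 1 - 1] @ drop 4 ws))"
      by (rule computable_append_drop) (auto intro: computable_nth computable_pred[simplified])
  qed (auto intro: computable_nth)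
  fix zs :: "nat list"
  assume "length zs = k + 1"
  then obtain n xs where zs: "zs = n # xs" and len: "length xs = k"
    by (auto simp: length_Suc_conv)
  show "?A (t # zs) = Suc v" if "s \<le> t" "?A (s # zs) = Suc v" for s t v
    using that(2) unfolding zs A
  proof (induction n arbitrary: v)
    case 0
    then show ?case using G len that(1) by (simp add: B_def approximates_def)
  next
    case (Suc n)
    then show ?case using H len that(1) by (fastforce simp: B_Suc approximates_def)
  qed
  show "prim_recursion G H zs = Some v" if "?A (t # zs) = Suc v" for t v
    using that unfolding zs A
  proof (induction n arbitrary: v)
    case 0
    then show ?case using G len by (auto simp: B_def approximates_def prim_recursion_def)
  next
    case (Suc n)
    then obtain w where w: "B t xs n = Suc w" "Ha (t # n # w # xs) = Suc v"
      by (auto simp: B_Suc)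
    moreover have "H (n # w # xs) = Some v"
      using H len w(2) unfolding approximates_def by fastforce
    ultimately show ?case using Suc.IH P_Suc by blast
  qed
  show "\<forall>\<^sub>F t in sequentially. ?A (t # zs) = Suc v" if "prim_recursion G H zs = Some v" for v
    using that unfolding zs A
  proof (induction n arbitrary: v)
    case 0
    then show ?case
      using approximates_eventually[OF G len] by (simp add: B_def prim_recursion_def)
  next
    case (Suc n)
    then obtain w where w: "prim_recursion G H (n # xs) = Some w" "H (n # w # xs) = Some v"
      by (auto simp: P_Suc)
    have "\<forall>\<^sub>F t in sequentially. Ha (t # n # w # xs) = Suc v"
      using w(2) len by (subst approximates_eventually[OF H, symmetric]) auto
    with Suc.IH[OF w(1)] show ?case
      by eventually_elim (auto simp: B_Suc)
  qed
qed

text \<open>The stage bounds the search as well as the evaluation of each candidate. Stopping at an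
  undefined value makes the result monotone: no zero is reported while a smaller candidate, which
  may itself turn out to be a zero, is unsettled.\<close>

lemma approximates_minimization:
  assumes F: "approximates (k + 1) Fa F"
  shows "\<exists>A. approximates k A (minimization F)"
proof (intro exI approximatesI)
  \<comment> \<open>Here \<open>ws = m # r # t # xs\<close>, so this is \<open>Fa\<close> at stage
    \<open>t\<close> and candidate \<open>m\<close>. Value 0 means undefined so far, 1 means output
    0, and anything larger means a positive output.\<close>
  let ?f = "\<lambda>ws. Fa (map (\<lambda>h. h ws) [\<lambda>ws. ws ! 2, \<lambda>ws. ws ! 0] @ drop 3 ws)"
  let ?h = "\<lambda>ws. if ws ! 1 = 0 then if ?f ws = 0 then 1 else if ?f ws = 1 then Suc (Suc (ws ! 0)) else 0
    else ws ! 1"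
  \<comment> \<open>The final \<open>- 1\<close> turns the states 0 and 1 both into 0, "not yet
    defined", and \<open>Suc (Suc y)\<close> into \<open>Suc y\<close>, the code of output
    \<open>y\<close>.\<close>
  let ?A = "\<lambda>xs. rec_nat 0 (\<lambda>m r. ?h (m # r # xs)) (xs ! 0) - 1"
  text \<open>The search up to \<open>n\<close> is in state \<open>0\<close> while it continues, \<open>1\<close> when it met an undefined value,
    and \<open>Suc (Suc y)\<close> when it found the zero \<open>y\<close>.\<close>
  define B where "B t xs = rec_nat 0 (\<lambda>m r. if r = 0 then if Fa (t # m # xs) = 0 then 1
      else if Fa (t # m # xs) = 1 then Suc (Suc m) else 0 else r)" for t xs
  have "?h (m # r # t # xs) = (if r = 0 then if Fa (t # m # xs) = 0 then 1
      else if Fa (t # m # xs) = 1 then Suc (Suc m) else 0 else r)" for m r t xs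
    by (simp add: numeral_eq_Suc)
  then have A: "?A (t # xs) = B t xs t - 1" for t xs
    by (simp only: B_def) simp
  have diff_1_eq: "n - 1 = Suc v \<longleftrightarrow> n = Suc (Suc v)" for n v
    by auto
  have gt_1: "n > 1 \<longleftrightarrow> (\<exists>w. n = Suc (Suc w))" for n :: nat
    by (auto simp: less_iff_Suc_add)
  \<comment> \<open>The two characterisations need a joint induction: \<open>n\<close> can be found
    only from state 0, which means that all smaller candidates have shown a positive output.\<close>
  have "(B t xs n = 0 \<longleftrightarrow> (\<forall>z<n. Fa (t # z # xs) > 1)) \<and>
      (B t xs n = Suc (Suc v) \<longleftrightarrow> v < n \<and> Fa (t # v # xs) = 1 \<and> (\<forall>z<v. Fa (t # z # xs) > 1))"
    for t xs n v
    by (induction n) (auto simp: B_def less_Suc_eq)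
  then have A_iff: "?A (t # xs) = Suc v \<longleftrightarrow>
      v < t \<and> Fa (t # v # xs) = 1 \<and> (\<forall>z<v. \<exists>w. Fa (t # z # xs) = Suc (Suc w))" for t xs v
    unfolding A by (simp only: gt_1 diff_1_eq)
  show "computable (Suc k) ?A"
  proof -
    have "computable (k + 2) Fa"
      using F by (simp add: approximates_def)
    then have "computable (Suc k + 2) ?f"
      by (rule computable_append_drop) (auto intro: computable_nth)
    then show ?thesis
      by (intro computable_pred computable_rec computable_if_eq_0 computable_If decidable_eq_const
          computable_const computable_Suc computable_nth) auto
  qed
  have min_iff: "minimization F xs = Some v \<longleftrightarrow>
      F (v # xs) = Some 0 \<and> (\<forall>z<v. \<exists>w. F (z # xs) = Some (Suc w))"
    (is "_ \<longleftrightarrow> ?P v") for xs v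
  proof -
    have "(LEAST y. F (y # xs) = Some 0) = y" if "?P y" for y
      using that by (intro Least_equality) (auto simp: not_less[symmetric])
    then show ?thesis
      unfolding minimization_def by auto
  qed
  fix xs :: "nat list"
  assume len: "length xs = k"
  have mono: "Fa (s # z # xs) = Suc v \<Longrightarrow> s \<le> t \<Longrightarrow> Fa (t # z # xs) = Suc v" for s t z v
    using F len unfolding approximates_def by (metis Suc_eq_plus1 length_Cons)
  show "?A (t # xs) = Suc v" if "s \<le> t" "?A (s # xs) = Suc v" for s t v
    using that mono unfolding A_iff by (metis One_nat_def order_less_le_trans)
  have sound: "Fa (t # z # xs) = Suc v \<Longrightarrow> F (z # xs) = Some v" for t z v
    using F len unfolding approximates_def by (metis Suc_eq_plus1 length_Cons)
  show "minimization F xs = Some v" if "?A (t # xs) = Suc v" for t v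
    using that sound unfolding A_iff min_iff by (metis One_nat_def)
  show "\<forall>\<^sub>F t in sequentially. ?A (t # xs) = Suc v" if "minimization F xs = Some v" for v
  proof -
    have complete: "\<forall>\<^sub>F t in sequentially. Fa (t # z # xs) = Suc w" if "F (z # xs) = Some w" for z w
      using that len by (subst approximates_eventually[OF F, symmetric]) auto
    have "\<forall>\<^sub>F t in sequentially. \<exists>w. Fa (t # z # xs) = Suc (Suc w)" if "z < v" for z
    proof -
      obtain w where "F (z # xs) = Some (Suc w)"
        using \<open>minimization F xs = Some v\<close> \<open>z < v\<close> by (auto simp: min_iff)
      from complete[OF this] show ?thesis by eventually_elim blast
    qed
    then have "\<forall>\<^sub>F t in sequentially. \<forall>z\<in>{..<v}. \<exists>w. Fa (t # z # xs) = Suc (Suc w)"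
      by (intro eventually_ball_finite) auto
    moreover have "\<forall>\<^sub>F t in sequentially. Fa (t # v # xs) = Suc 0"
      using complete that by (simp add: min_iff)
    ultimately show ?thesis
      using eventually_gt_at_top[of v] unfolding A_iff by eventually_elim simp
  qed
qed

lemma ex_approximation:
  assumes "partial_recursive k F"
  shows "\<exists>A. approximates k A F"
  using assms
proof induction
  case (zero k)
  then show ?case using approximates_total computable_const by blast
next
  case succ
  have "computable 1 (\<lambda>xs. Suc (hd xs))"
    unfolding computable_def using partial_recursive.succ by blast
  then show ?case using approximates_total by blast
next
  case (proj i k)
  then show ?case using approximates_total computable_nth by blast
next
  case (comp gs f k)
  obtain Fa where "approximates (length gs) Fa f" using comp.IH(1) by blast
  moreover obtain Ga where "\<And>g. g \<in> set gs \<Longrightarrow> approximates k (Ga g) g" using comp.IH(2) by metis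
  ultimately show ?case by (rule approximates_compose)
next
  case (prec k g h)
  then show ?case using approximates_prim_recursion by blast
next
  case (minim k f)
  then show ?case using approximates_minimization by blast
qed

section \<open>Acceptable numberings\<close>

text \<open>Explicit lists remove the length conditions. \<open>G [t, x, y]\<close> is 0 while no
  output has appeared and 2 once output 1 has; the upper bounds are built from these tests.\<close>

lemma universal_approximation:
  assumes "acceptable_numbering \<phi>"
  obtains G where "computable 3 G"
    and "\<And>s t x y v. s \<le> t \<Longrightarrow> G [s, x, y] = Suc v \<Longrightarrow> G [t, x, y] = Suc v"
    and "\<And>x y v. \<phi> x y = Some v \<longleftrightarrow> (\<exists>t. G [t, x, y] = Suc v)"
proof -
  obtain F where F: "partial_recursive 2 F" "\<And>x y. F [x, y] = \<phi> x y"
    using assms unfolding acceptable_numbering_def partial_computable2_def by blast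
  obtain G where G: "approximates 2 G F"
    using ex_approximation[OF F(1)] by blast
  show ?thesis
  proof
    show "computable 3 G"
      using G by (simp add: approximates_def numeral_eq_Suc)
    show "G [t, x, y] = Suc v" if "s \<le> t" "G [s, x, y] = Suc v" for s t x y v
      using G that unfolding approximates_def by fastforce
    have "F [x, y] = Some v \<longleftrightarrow> (\<exists>t. G [t, x, y] = Suc v)" for x y v
      using G by (simp add: approximates_def)
    then show "\<phi> x y = Some v \<longleftrightarrow> (\<exists>t. G [t, x, y] = Suc v)" for x y v
      by (simp only: F(2))
  qed
qed

lemma smn_search:
  assumes "acceptable_numbering \<phi>" and "decidable 3 R"
  obtains s where "total_computable s"
    and "\<And>x y. \<phi> (s x) y = (if \<exists>z. R [x, y, z] then Some c else None)"
proof -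
  \<comment> \<open>\<open>minimization\<close> searches over the first argument and stops at value
    0, so \<open>z\<close> moves to the front and \<open>R\<close> is negated.\<close>
  have "decidable 3 (\<lambda>xs. \<not> R [xs ! 1, xs ! 2, xs ! 0])"
    using decidable_comp[OF assms(2), of "[\<lambda>xs. xs ! 1, \<lambda>xs. xs ! 2, \<lambda>xs. xs ! 0]" 3]
    by (intro decidable_not) (auto simp: computable_nth)
  then obtain F where F: "partial_recursive 3 F"
      "\<And>x y z. F [z, x, y] = Some (if R [x, y, z] then 0 else 1)"
    unfolding decidable_def by fastforce
  \<comment> \<open>Composing with \<open>C\<close> replaces the witness found by the fixed output
    \<open>c\<close> and passes on divergence of the search.\<close>
  obtain C where C: "partial_recursive 1 C" "\<And>x. C [x] = Some c"
    using computable_const[of 1 c] unfolding computable_def by fastforce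
  have none: "minimization F [x, y] = None \<longleftrightarrow> (\<nexists>z. R [x, y, z])" for x y
  proof -
    have "(\<exists>z. R [x, y, z]) \<Longrightarrow> \<exists>z. R [x, y, z] \<and> (\<forall>z'<z. \<not> R [x, y, z'])"
      using exists_least_iff[of "\<lambda>z. R [x, y, z]"] by blast
    then show ?thesis
      unfolding minimization_def F(2) by auto
  qed
  have "compose C [minimization F] [x, y] = (if \<exists>z. R [x, y, z] then Some c else None)" for x y
    using none[of x y] by (cases "minimization F [x, y]") (auto simp: compose_def C(2))
  moreover have "partial_recursive 2 (compose C [minimization F])"
    using C(1) F(1) by (intro comp) (auto intro: minim simp: numeral_eq_Suc)
  ultimately have "partial_computable2 (\<lambda>x y. if \<exists>z. R [x, y, z] then Some c else None)"
    unfolding partial_computable2_def by blast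
  then show ?thesis
    using assms(1) that unfolding acceptable_numbering_def by blast
qed

text \<open>The condition does not involve \<open>y\<close>, so \<open>s x\<close> indexes either a
  constant function or the empty one. This dichotomy drives hardness at the first level.\<close>

lemma smn_search_constant:
  assumes "acceptable_numbering \<phi>" and "decidable 2 R"
  obtains s where "total_computable s"
    and "\<And>x y. \<phi> (s x) y = (if \<exists>z. R [x, z] then Some c else None)"
proof -
  have "decidable 3 (\<lambda>xs. R [xs ! 0, xs ! 2])"
    using decidable_comp[OF assms(2), of "[\<lambda>xs. xs ! 0, \<lambda>xs. xs ! 2]" 3]
    by (auto simp: computable_nth)
  from smn_search[OF assms(1) this, of c] that show ?thesis
    by auto
qed

section \<open>Hardness criteria from constant and undefined functions\<close>

lemma complete_for_Pi01I:
  assumes "acceptable_numbering \<phi>" and "B \<in> Pi01"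
    and "\<And>a. \<forall>y. \<phi> a y = Some 1 \<Longrightarrow> a \<notin> B" and "\<And>a. \<forall>y. \<phi> a y = None \<Longrightarrow> a \<in> B"
  shows "complete_for Pi01 B"
  unfolding complete_for_def
proof (intro conjI ballI)
  fix A :: "nat set"
  assume "A \<in> Pi01"
  then obtain R where R: "decidable 2 R" "A = {x. \<forall>y. R [x, y]}"
    unfolding Pi01_def by blast
  \<comment> \<open>The search is for a counterexample: for members of \<open>A\<close> it never
    ends and \<open>s x\<close> indexes the empty function; otherwise \<open>s x\<close> indexes the
    constant 1.\<close>
  obtain s where s: "total_computable s"
      "\<And>x y. \<phi> (s x) y = (if \<exists>z. \<not> R [x, z] then Some 1 else None)"
    using smn_search_constant[OF assms(1) decidable_not[OF R(1)]] by blast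
  have "x \<in> A \<longleftrightarrow> s x \<in> B" for x
    using s(2)[of x] assms(3,4)[of "s x"] unfolding R(2) by (cases "\<forall>y. R [x, y]") auto
  then show "A \<le>\<^sub>m B"
    unfolding many_one_reducible_def using s(1) by blast
qed (fact assms(2))

text \<open>Now the search is for a witness, so members give constant functions. The output
  \<open>c\<close> stays open because \<open>H_i\<close> calls for 1 and \<open>H_ii\<close> for
  another value.\<close>

lemma complete_for_Sigma01I:
  assumes "acceptable_numbering \<phi>" and "B \<in> Sigma01"
    and "\<And>a. \<forall>y. \<phi> a y = Some c \<Longrightarrow> a \<in> B" and "\<And>a. \<forall>y. \<phi> a y = None \<Longrightarrow> a \<notin> B"
  shows "complete_for Sigma01 B"
  unfolding complete_for_def
proof (intro conjI ballI)
  fix A :: "nat set"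
  assume "A \<in> Sigma01"
  then obtain R where R: "decidable 2 R" "A = {x. \<exists>y. R [x, y]}"
    unfolding Sigma01_def by blast
  obtain s where s: "total_computable s"
      "\<And>x y. \<phi> (s x) y = (if \<exists>z. R [x, z] then Some c else None)"
    using smn_search_constant[OF assms(1) R(1)] by blast
  have "x \<in> A \<longleftrightarrow> s x \<in> B" for x
    using s(2)[of x] assms(3,4)[of "s x"] unfolding R(2) by (cases "\<exists>y. R [x, y]") auto
  then show "A \<le>\<^sub>m B"
    unfolding many_one_reducible_def using s(1) by blast
qed (fact assms(2))

text \<open>The input \<open>y\<close> of the constructed function takes the role of the universally
  quantified variable: one \<open>y\<close> without a witness makes \<open>s x\<close> diverge
  there.\<close>

lemma complete_for_Pi02I:
  assumes "acceptable_numbering \<phi>" and "B \<in> Pi02"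
    and "\<And>a. \<forall>y. \<phi> a y = Some c \<Longrightarrow> a \<in> B" and "\<And>a. \<exists>y. \<phi> a y = None \<Longrightarrow> a \<notin> B"
  shows "complete_for Pi02 B"
  unfolding complete_for_def
proof (intro conjI ballI)
  fix A :: "nat set"
  assume "A \<in> Pi02"
  then obtain R where R: "decidable 3 R" "A = {x. \<forall>y. \<exists>z. R [x, y, z]}"
    unfolding Pi02_def by blast
  obtain s where s: "total_computable s"
      "\<And>x y. \<phi> (s x) y = (if \<exists>z. R [x, y, z] then Some c else None)"
    using smn_search[OF assms(1) R(1)] by blast
  have "x \<in> A \<longleftrightarrow> s x \<in> B" for x
    using s(2)[of x] assms(3,4)[of "s x"] unfolding R(2) by (cases "\<forall>y. \<exists>z. R [x, y, z]") auto
  then show "A \<le>\<^sub>m B"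
    unfolding many_one_reducible_def using s(1) by blast
qed (fact assms(2))

section \<open>Classification of the index sets\<close>

theorem theorem8p1:
  fixes \<phi> :: "nat \<Rightarrow> nat \<rightharpoonup> nat" and d :: "nat \<Rightarrow> nat"
  assumes "acceptable_numbering \<phi>"
    and "diagonal_function \<phi> d"
  shows "complete_for Pi01 (sound_adjudicators \<phi>) \<and>
    (complete_for Pi02 (total_adjudicators \<phi>) \<and>
     complete_for Pi02 (ET_set \<phi>) \<and>
     complete_for Pi02 (total_adjudicators \<phi> \<inter> sound_adjudicators \<phi>)) \<and>
    (complete_for Sigma01 (H_i \<phi> d) \<and>
     complete_for Sigma01 (H_ii \<phi> d) \<and>
     complete_for Pi01 (H_iii \<phi> d))"
proof -
  obtain G where G: "computable 3 G"
      and mono: "\<And>s t x y v. s \<le> t \<Longrightarrow> G [s, x, y] = Suc v \<Longrightarrow> G [t, x, y] = Suc v"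
      and conv: "\<And>x y v. \<phi> x y = Some v \<longleftrightarrow> (\<exists>t. G [t, x, y] = Suc v)"
    using universal_approximation[OF assms(1)] by blast
  have div: "\<phi> x y = None \<longleftrightarrow> (\<forall>t. G [t, x, y] = 0)" for x y
    using conv[of x y] by (metis not0_implies_Suc old.nat.distinct(2) option.exhaust option.distinct(1))
  have G3: "computable k (\<lambda>xs. G [f xs, g xs, h xs])"
    if "computable k f" "computable k g" "computable k h" for k f g h
    using computable_comp[OF G, of "[f, g, h]" k] that by auto
  have d: "computable k (\<lambda>xs. d (f xs))" if "computable k f" for k f
  proof -
    have "computable 1 (\<lambda>xs. d (xs ! 0))"
      using assms(2) unfolding diagonal_function_def total_computable_def partial_computable1_def
        computable_def by (auto simp: length_Suc_conv)
    from computable_comp[OF this, of "[f]" k] that show ?thesis by auto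
  qed

  \<comment> \<open>A decidable matrix for soundness: \<open>xs ! 1\<close> bounds the candidate
    \<open>p\<close> and is also the stage of both computations. The value 2 is
    \<open>Suc 1\<close>, the code of output 1.\<close>
  define Q where "Q xs \<longleftrightarrow> (\<forall>p<xs ! 1. \<not> (G [xs ! 1, xs ! 0, p] = 2 \<and> G [xs ! 1, p, 0] = 2))" for xs
  \<comment> \<open>The bounded variable becomes the first list entry, which shifts the other
    indices by one.\<close>
  have "decidable 2 (\<lambda>xs. \<forall>p<xs ! 1. \<not> (G [(p # xs) ! 2, (p # xs) ! 1, (p # xs) ! 0] = 2 \<and>
      G [(p # xs) ! 2, (p # xs) ! 0, 0] = 2))"
    by (intro decidable_all_less decidable_not decidable_conj decidable_eq_const G3 computable_nth
        computable_const) auto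
  then have Q: "decidable 2 Q"
    by (rule decidable_cong) (simp add: Q_def numeral_eq_Suc)
  have sound: "a \<in> sound_adjudicators \<phi> \<longleftrightarrow> (\<forall>n. Q [a, n])" for a
  proof
    assume *: "a \<in> sound_adjudicators \<phi>"
    show "\<forall>n. Q [a, n]"
      using * conv by (auto simp: Q_def sound_adjudicators_def M_set_def numeral_2_eq_2)
  next
    assume *: "\<forall>n. Q [a, n]"
    have False if "\<phi> a p = Some 1" "\<phi> p 0 = Some 1" for p
    proof -
      obtain s t where "G [s, a, p] = 2" "G [t, p, 0] = 2"
        using \<open>\<phi> a p = Some 1\<close> \<open>\<phi> p 0 = Some 1\<close> unfolding conv by (auto simp: numeral_2_eq_2)
      \<comment> \<open>This bound dominates both stages and strictly exceeds \<open>p\<close>, as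
        the quantifier in \<open>Q\<close> demands.\<close>
      then have "\<not> Q [a, s + t + Suc p]"
        using mono[of s "s + t + Suc p" a p 1] mono[of t "s + t + Suc p" p 0 1]
        by (auto simp: Q_def numeral_2_eq_2 intro!: exI[of _ p])
      then show False using * by blast
    qed
    then show "a \<in> sound_adjudicators \<phi>"
      by (auto simp: sound_adjudicators_def M_set_def)
  qed
  \<comment> \<open>For the hardness of soundness: an index of the constant 1 function accepts this
    member of \<open>M_set\<close>, hence is unsound.\<close>
  have M: "\<exists>p. p \<in> M_set \<phi>"
  proof -
    have "partial_computable1 (\<lambda>y. Some 1)"
      using computable_const[of 1 1] unfolding partial_computable1_def computable_def by fastforce
    then have "(\<lambda>y. Some 1) \<in> range \<phi>"
      using assms(1) by (simp add: acceptable_numbering_def)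
    then obtain p where "\<phi> p = (\<lambda>y. Some 1)"
      by (metis rangeE)
    then have "\<phi> p 0 = Some 1" by simp
    then show ?thesis by (auto simp: M_set_def)
  qed

  have S: "complete_for Pi01 (sound_adjudicators \<phi>)"
  proof (rule complete_for_Pi01I[OF assms(1)])
    show "sound_adjudicators \<phi> \<in> Pi01"
      unfolding Pi01_def using Q sound by blast
  qed (use M in \<open>auto simp: sound_adjudicators_def\<close>)

  have T: "complete_for Pi02 (total_adjudicators \<phi>)"
  proof (rule complete_for_Pi02I[OF assms(1), where c = 1])
    have "decidable 3 (\<lambda>xs. G [xs ! 2, xs ! 0, xs ! 1] \<noteq> 0)"
      by (intro decidable_not decidable_eq_const G3 computable_nth) auto
    moreover have "total_adjudicators \<phi> = {a. \<forall>p. \<exists>t. G [[a, p, t] ! 2, [a, p, t] ! 0, [a, p, t] ! 1] \<noteq> 0}"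
      by (simp add: total_adjudicators_def div)
    ultimately show "total_adjudicators \<phi> \<in> Pi02"
      unfolding Pi02_def by blast
  qed (auto simp: total_adjudicators_def)

  have ET: "complete_for Pi02 (ET_set \<phi>)"
  proof (rule complete_for_Pi02I[OF assms(1), where c = 1])
    have "decidable 3 (\<lambda>xs. G [xs ! 2, xs ! 0, xs ! 1] = 2)"
      by (intro decidable_eq_const G3 computable_nth) auto
    moreover have "ET_set \<phi> = {a. \<forall>p. \<exists>t. G [[a, p, t] ! 2, [a, p, t] ! 0, [a, p, t] ! 1] = 2}"
      by (simp add: ET_set_def conv numeral_2_eq_2)
    ultimately show "ET_set \<phi> \<in> Pi02"
      unfolding Pi02_def by blast
  qed (fastforce simp: ET_set_def)+

  have TS: "complete_for Pi02 (total_adjudicators \<phi> \<inter> sound_adjudicators \<phi>)"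
  \<comment> \<open>The constant 0 is total and vacuously sound, whereas the constant 1 would be
    unsound by \<open>M\<close>.\<close>
  proof (rule complete_for_Pi02I[OF assms(1), where c = 0])
    have "decidable 3 (\<lambda>xs. Q [xs ! 0, xs ! 1])"
      using decidable_comp[OF Q, of "[\<lambda>xs. xs ! 0, \<lambda>xs. xs ! 1]" 3] by (auto simp: computable_nth)
    then have "decidable 3 (\<lambda>xs. \<not> G [xs ! 2, xs ! 0, xs ! 1] = 0 \<and> Q [xs ! 0, xs ! 1])"
      by (intro decidable_conj decidable_not decidable_eq_const G3 computable_nth) auto
    \<comment> \<open>One \<open>p\<close> serves both as the input for totality and as the bound in
      \<open>Q\<close>; the \<open>Q\<close> conjunct does not mention \<open>t\<close>, so it may
      stand under the existential quantifier.\<close>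
    moreover have "total_adjudicators \<phi> \<inter> sound_adjudicators \<phi> = {a. \<forall>p. \<exists>t.
        \<not> G [[a, p, t] ! 2, [a, p, t] ! 0, [a, p, t] ! 1] = 0 \<and> Q [[a, p, t] ! 0, [a, p, t] ! 1]}"
      by (auto simp: total_adjudicators_def div sound)
    ultimately show "total_adjudicators \<phi> \<inter> sound_adjudicators \<phi> \<in> Pi02"
      unfolding Pi02_def by blast
  qed (auto simp: total_adjudicators_def sound_adjudicators_def)

  \<comment> \<open>Computability of \<open>d\<close> reduces the three sets to halting tests at one
    input computed from \<open>a\<close>. For hardness, constant and empty functions behave as
    required at \<open>d a\<close>, wherever it lies.\<close>
  have Gd: "computable 2 (\<lambda>xs. G [xs ! 1, xs ! 0, d (xs ! 0)])"
    by (intro G3 computable_nth d) auto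

  have Hi: "complete_for Sigma01 (H_i \<phi> d)"
  proof (rule complete_for_Sigma01I[OF assms(1), where c = 1])
    have "H_i \<phi> d = {a. \<exists>t. G [[a, t] ! 1, [a, t] ! 0, d ([a, t] ! 0)] = 2}"
      by (simp add: H_i_def conv numeral_2_eq_2)
    then show "H_i \<phi> d \<in> Sigma01"
      unfolding Sigma01_def using decidable_eq_const[OF Gd, of 2] by blast
  qed (auto simp: H_i_def)

  have Hii: "complete_for Sigma01 (H_ii \<phi> d)"
  proof (rule complete_for_Sigma01I[OF assms(1), where c = 0])
    \<comment> \<open>Code neither 0 nor 2: an output has appeared, and it differs from 1.\<close>
    have "decidable 2 (\<lambda>xs. \<not> G [xs ! 1, xs ! 0, d (xs ! 0)] = 0 \<and> \<not> G [xs ! 1, xs ! 0, d (xs ! 0)] = 2)"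
      by (intro decidable_conj decidable_not decidable_eq_const Gd)
    moreover have "H_ii \<phi> d = {a. \<exists>t. \<not> G [[a, t] ! 1, [a, t] ! 0, d ([a, t] ! 0)] = 0 \<and>
        \<not> G [[a, t] ! 1, [a, t] ! 0, d ([a, t] ! 0)] = 2}"
      by (auto simp: H_ii_def conv numeral_2_eq_2 gr0_conv_Suc)
    ultimately show "H_ii \<phi> d \<in> Sigma01"
      unfolding Sigma01_def by blast
  qed (auto simp: H_ii_def)

  have Hiii: "complete_for Pi01 (H_iii \<phi> d)"
  proof (rule complete_for_Pi01I[OF assms(1)])
    have "H_iii \<phi> d = {a. \<forall>t. G [[a, t] ! 1, [a, t] ! 0, d ([a, t] ! 0)] = 0}"
      by (simp add: H_iii_def div)
    then show "H_iii \<phi> d \<in> Pi01"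
      unfolding Pi01_def using decidable_eq_const[OF Gd, of 0] by blast
  qed (auto simp: H_iii_def)

  show ?thesis
    using S T ET TS Hi Hii Hiii by blast
qed

end
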